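(* Let $\alpha\in\overline{\mathbb{D}}$ and $\phi(z)=\alpha z$ for $z\in\mathbb{D}$. Then the Berezin range of the composition operator $C_\phi$ acting on the Hardy space $H^2(\mathbb{D})$ is convex if and only if $\alpha$ is real with $-1\le\alpha\le 1$.
   Context: $\mathbb{D}$ is the open unit disc in $\mathbb{C}$ and $\overline{\mathbb{D}}$ its closure. $H^2(\mathbb{D})$ is the Hilbert space of holomorphic functions $f(z)=\sum_{n\ge0}a_nz^n$ on $\mathbb{D}$ with $\sum_n|a_n|^2<\infty$, with inner product $\langle \sum a_nz^n,\sum b_nz^n\rangle=\sum a_n\overline{b_n}$; its reproducing kernel at $w\in\mathbb{D}$ is $k_w(z)=\frac{1}{1-\overline{w}z}$. The normalized reproducing kernel is $\hat{k}_w=k_w/\|k_w\|$. The composition operator is $C_\phi f=f\circ\phi$. The Berezin range of a bounded operator $T$ on $H^2(\mathbb{D})$ is $\mathrm{Ber}(T)=\{\langle T\hat{k}_w,\hat{k}_w\rangle : w\in\mathbb{D}\}\subseteq\mathbb{C}$. *)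

theory Defs
  imports "HOL-Complex_Analysis.Complex_Analysis" "HOL-Library.FuncSet"
begin

text \<open>
  Elements of the Hardy space are represented by functions on the whole plane of which only
  the values on the open unit disc \<^term>\<open>ball 0 1 :: complex set\<close> matter: membership in
  the space and the inner product depend only on the restriction to the disc, and so does
  composition with a symbol that maps the disc into itself. Two functions that agree on the disc
  stand for the same element.
\<close>

abbreviation hardy_coeff :: "(complex \<Rightarrow> complex) \<Rightarrow> nat \<Rightarrow> complex" where
  "hardy_coeff f n \<equiv> fps_nth (fps_expansion f 0) n"

definition hardy_space :: "(complex \<Rightarrow> complex) set" where
  "hardy_space =
     {f. f holomorphic_on ball 0 1 \<and> summable (\<lambda>n. (cmod (hardy_coeff f n))\<^sup>2)}"

definition hardy_inner :: "(complex \<Rightarrow> complex) \<Rightarrow> (complex \<Rightarrow> complex) \<Rightarrow> complex" where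
  "hardy_inner f g = (\<Sum>n. hardy_coeff f n * cnj (hardy_coeff g n))"

definition hardy_norm :: "(complex \<Rightarrow> complex) \<Rightarrow> real" where
  "hardy_norm f = sqrt (Re (hardy_inner f f))"

definition hardy_kernel :: "complex \<Rightarrow> complex \<Rightarrow> complex" where
  "hardy_kernel w z = 1 / (1 - cnj w * z)"

definition normalized_hardy_kernel :: "complex \<Rightarrow> complex \<Rightarrow> complex" where
  "normalized_hardy_kernel w z = hardy_kernel w z / complex_of_real (hardy_norm (hardy_kernel w))"

definition composition_operator ::
    "(complex \<Rightarrow> complex) \<Rightarrow> (complex \<Rightarrow> complex) \<Rightarrow> complex \<Rightarrow> complex" where
  "composition_operator \<phi> = (\<lambda>f\<in>hardy_space. f \<circ> \<phi>)"

definition berezin_range :: "((complex \<Rightarrow> complex) \<Rightarrow> complex \<Rightarrow> complex) \<Rightarrow> complex set" where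
  "berezin_range T =
     {hardy_inner (T (normalized_hardy_kernel w)) (normalized_hardy_kernel w) |w. w \<in> ball 0 1}"

end

theory Submission imports Defs begin

text \<open>
  Writing \<open>t = |w|\<^sup>2\<close>, the Berezin range is the curve \<open>(1 - t) / (1 - t \<alpha>)\<close>, \<open>0 \<le> t < 1\<close>.
  For real \<open>\<alpha>\<close> it is the continuous image of an interval in the real line, hence convex.
  Conversely, if the midpoint of the values at \<open>t = 0\<close> and \<open>t = 1/2\<close> is the value at some
  \<open>t\<close>, then clearing denominators gives \<open>\<alpha> = 1\<close> or \<open>t (4 - \<alpha>) = 1\<close>, so \<open>\<alpha>\<close> is real.
\<close>

lemma one_minus_mult_nonzero:
  fixes a z :: complex
  assumes "cmod a \<le> 1" "cmod z < 1"
  shows "1 - a * z \<noteq> 0"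
proof
  assume "1 - a * z = 0"
  then have "cmod (a * z) = 1" by simp
  moreover have "cmod (a * z) \<le> 1 * cmod z"
    unfolding norm_mult using assms by (intro mult_right_mono) auto
  ultimately show False using assms by simp
qed

text \<open>On the disc \<open>f\<close> is the sum of a geometric series, and a power series
  expansion at 0 is determined by the values near 0. Values of \<open>f\<close> off the disc are
  arbitrary, which suits representatives such as a composition with \<phi>.\<close>

lemma hardy_coeff_geometric:
  fixes f :: "complex \<Rightarrow> complex"
  assumes "cmod a \<le> 1" "\<And>z. z \<in> ball 0 1 \<Longrightarrow> f z = c / (1 - a * z)"
  shows "hardy_coeff f n = c * a ^ n"
proof -
  have "(\<lambda>n. fps_nth (Abs_fps (\<lambda>n. c * a ^ n)) n * z ^ n) sums f z" if "z \<in> ball 0 1" for z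
  proof -
    have "cmod (a * z) \<le> 1 * cmod z"
      unfolding norm_mult using assms(1) by (intro mult_right_mono) auto
    then have "cmod (a * z) < 1" using that by simp
    from sums_mult[OF geometric_sums[OF this], of c]
    show ?thesis using assms(2)[OF that] by (simp add: power_mult_distrib mult_ac)
  qed
  then have "\<forall>\<^sub>F z in nhds 0. (\<lambda>n. fps_nth (Abs_fps (\<lambda>n. c * a ^ n)) n * z ^ n) sums f z"
    by (intro eventually_mono[OF eventually_nhds_in_open[of "ball 0 1"]]) auto
  then have "f has_fps_expansion Abs_fps (\<lambda>n. c * a ^ n)"
    by (rule has_fps_expansionI)
  from fps_nth_fps_expansion[OF this, of n] show ?thesis
    by (simp add: fps_expansion_def)
qed

text \<open>The coefficient products again form a geometric series, of ratio
  \<open>a * cnj b\<close>. One strict bound makes it converge, so \<open>a\<close> may lie on the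
  unit circle.\<close>

lemma hardy_inner_geometric:
  fixes f g :: "complex \<Rightarrow> complex"
  assumes "cmod a \<le> 1" "\<And>z. z \<in> ball 0 1 \<Longrightarrow> f z = c / (1 - a * z)"
    and "cmod b < 1" "\<And>z. z \<in> ball 0 1 \<Longrightarrow> g z = d / (1 - b * z)"
  shows "hardy_inner f g = c * cnj d / (1 - a * cnj b)"
proof -
  have "cmod (a * cnj b) \<le> 1 * cmod b"
    unfolding norm_mult complex_mod_cnj using assms(1) by (intro mult_right_mono) auto
  then have "cmod (a * cnj b) < 1" using assms(3) by simp
  from sums_mult[OF geometric_sums[OF this], of "c * cnj d"]
  have "(\<lambda>n. c * a ^ n * cnj (d * b ^ n)) sums (c * cnj d / (1 - a * cnj b))"
    by (simp add: power_mult_distrib mult_ac)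
  then show ?thesis
    unfolding hardy_inner_def using assms
    by (subst hardy_coeff_geometric[of a f c], simp, simp,
        subst hardy_coeff_geometric[of b g d]) (auto simp: sums_iff)
qed

lemma hardy_norm_kernel:
  assumes "w \<in> ball 0 1"
  shows "hardy_norm (hardy_kernel w) = 1 / sqrt (1 - (cmod w)\<^sup>2)"
proof -
  have "hardy_inner (hardy_kernel w) (hardy_kernel w) = 1 / (1 - cnj w * w)"
    using assms hardy_inner_geometric[of "cnj w" "hardy_kernel w" 1 "cnj w" "hardy_kernel w" 1]
    by (simp add: hardy_kernel_def)
  also have "\<dots> = complex_of_real (1 / (1 - (cmod w)\<^sup>2))"
    by (simp add: mult.commute[of "cnj w"] complex_norm_square[symmetric])
  finally show ?thesis
    by (simp add: hardy_norm_def real_sqrt_divide)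
qed

text \<open>\<open>composition_operator\<close> is a restricted function, \<open>undefined\<close>
  off \<open>hardy_space\<close>; this membership is what allows it to be unfolded on the
  kernels.\<close>

lemma normalized_hardy_kernel_in_hardy_space:
  assumes "w \<in> ball 0 1"
  shows "normalized_hardy_kernel w \<in> hardy_space"
proof -
  define c where "c = 1 / complex_of_real (hardy_norm (hardy_kernel w))"
  have eq: "normalized_hardy_kernel w z = c / (1 - cnj w * z)" for z
    by (simp add: normalized_hardy_kernel_def hardy_kernel_def c_def)
  have w: "cmod w < 1" using assms by simp
  have coeff: "hardy_coeff (normalized_hardy_kernel w) n = c * cnj w ^ n" for n
    using w by (intro hardy_coeff_geometric) (auto simp: eq)
  have "(\<lambda>z. c / (1 - cnj w * z)) holomorphic_on ball 0 1"
    using w by (intro holomorphic_intros one_minus_mult_nonzero) auto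
  moreover have "summable (\<lambda>n. (cmod c)\<^sup>2 * ((cmod w)\<^sup>2) ^ n)"
    using w by (intro summable_mult summable_geometric) (simp add: abs_square_less_1)
  moreover have "(\<lambda>z. c / (1 - cnj w * z)) = normalized_hardy_kernel w"
    by (simp add: eq fun_eq_iff)
  moreover have "(cmod (hardy_coeff (normalized_hardy_kernel w) n))\<^sup>2 = (cmod c)\<^sup>2 * ((cmod w)\<^sup>2) ^ n" for n
    unfolding coeff by (simp add: norm_mult norm_power power_mult_distrib power_commutes flip: power_mult)
      (simp add: mult.commute)
  ultimately show ?thesis
    by (simp add: hardy_space_def)
qed

text \<open>Composing with \<phi> only changes the ratio of the geometric series from
  \<open>cnj w\<close> to \<open>cnj w * \<alpha>\<close>. Pairing with the kernel at
  \<open>w\<close> gives the ratio |w|^2 \<alpha>, and the two normalizing factors \<open>c\<close>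
  multiply to the numerator.\<close>

lemma berezin_transform_composition:
  assumes \<alpha>: "cmod \<alpha> \<le> 1" and \<phi>: "\<And>z. z \<in> ball 0 1 \<Longrightarrow> \<phi> z = \<alpha> * z"
    and w: "w \<in> ball 0 1"
  shows "hardy_inner (composition_operator \<phi> (normalized_hardy_kernel w))
           (normalized_hardy_kernel w) =
         complex_of_real (1 - (cmod w)\<^sup>2) / (1 - complex_of_real ((cmod w)\<^sup>2) * \<alpha>)"
proof -
  define c where "c = sqrt (1 - (cmod w)\<^sup>2)"
  have cw: "cmod w < 1" using w by simp
  have c2: "c * c = 1 - (cmod w)\<^sup>2"
    using cw by (simp add: c_def abs_square_le_1)
  have eq: "normalized_hardy_kernel w z = of_real c / (1 - cnj w * z)" for z
    by (simp add: normalized_hardy_kernel_def hardy_norm_kernel[OF w] hardy_kernel_def c_def)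
  have comp: "composition_operator \<phi> (normalized_hardy_kernel w) z
                = of_real c / (1 - (cnj w * \<alpha>) * z)" if "z \<in> ball 0 1" for z
    using normalized_hardy_kernel_in_hardy_space[OF w] \<phi>[OF that]
    by (simp add: composition_operator_def eq mult.assoc)
  have "cmod (cnj w * \<alpha>) \<le> 1"
    using mult_mono[of "cmod w" 1 "cmod \<alpha>" 1] cw \<alpha> by (simp add: norm_mult)
  from hardy_inner_geometric[OF this comp, of "cnj w" "normalized_hardy_kernel w" "of_real c"] cw
  have "hardy_inner (composition_operator \<phi> (normalized_hardy_kernel w)) (normalized_hardy_kernel w)
     = of_real (c * c) / (1 - (w * cnj w) * \<alpha>)"
    by (simp add: eq mult_ac)
  also have "w * cnj w = complex_of_real ((cmod w)\<^sup>2)"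
    by (rule complex_norm_square[symmetric])
  finally show ?thesis by (simp only: c2)
qed

lemma berezin_range_composition:
  assumes "cmod \<alpha> \<le> 1" "\<And>z. z \<in> ball 0 1 \<Longrightarrow> \<phi> z = \<alpha> * z"
  shows "berezin_range (composition_operator \<phi>) =
           (\<lambda>t. complex_of_real (1 - t) / (1 - complex_of_real t * \<alpha>)) ` {0..<1}"
proof -
  have "berezin_range (composition_operator \<phi>) =
          (\<lambda>w. complex_of_real (1 - (cmod w)\<^sup>2) / (1 - complex_of_real ((cmod w)\<^sup>2) * \<alpha>)) ` ball 0 1"
    unfolding berezin_range_def Setcompr_eq_image
    by (intro image_cong refl berezin_transform_composition assms)
  also have "\<dots> = (\<lambda>t. complex_of_real (1 - t) / (1 - complex_of_real t * \<alpha>)) `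
                    ((\<lambda>w::complex. (cmod w)\<^sup>2) ` ball 0 1)"
    by (simp add: image_image)
  also have "(\<lambda>w::complex. (cmod w)\<^sup>2) ` ball 0 1 = {0..<1}"
  proof (intro equalityI subsetI)
    fix t :: real assume "t \<in> {0..<1}"
    then show "t \<in> (\<lambda>w::complex. (cmod w)\<^sup>2) ` ball 0 1"
      \<comment> \<open>The transform depends on \<open>w\<close> only through its modulus, so a
        point on the real axis represents each \<open>t\<close>.\<close>
      by (intro image_eqI[of _ _ "complex_of_real (sqrt t)"]) auto
  qed (auto simp: abs_square_less_1)
  finally show ?thesis .
qed

theorem theorem4p1:
  fixes \<alpha> :: complex and \<phi> :: "complex \<Rightarrow> complex"
  assumes "\<alpha> \<in> cball 0 1"
    and "\<And>z. z \<in> ball 0 1 \<Longrightarrow> \<phi> z = \<alpha> * z"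
  shows "convex (berezin_range (composition_operator \<phi>)) \<longleftrightarrow>
           \<alpha> \<in> \<real> \<and> -1 \<le> Re \<alpha> \<and> Re \<alpha> \<le> 1"
proof -
  have \<alpha>: "cmod \<alpha> \<le> 1" using assms(1) by simp
  define B where "B t = complex_of_real (1 - t) / (1 - complex_of_real t * \<alpha>)" for t
  have range: "berezin_range (composition_operator \<phi>) = B ` {0..<1}"
    unfolding B_def[abs_def] by (rule berezin_range_composition[OF \<alpha> assms(2)])
  \<comment> \<open>Here \<open>t\<close> is read as a point of the open disc, so \<alpha> of
    modulus 1 is covered.\<close>
  have nz: "1 - complex_of_real t * \<alpha> \<noteq> 0" if "t \<in> {0..<1}" for t
    using one_minus_mult_nonzero[OF \<alpha>, of "of_real t"] that by (simp add: mult.commute)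
  show ?thesis
  proof
    assume "convex (berezin_range (composition_operator \<phi>))"
    moreover have "B 0 \<in> B ` {0..<1}" "B (1/2) \<in> B ` {0..<1}" by (auto intro!: imageI)
    ultimately have "(1/2) *\<^sub>R B 0 + (1/2) *\<^sub>R B (1/2) \<in> B ` {0..<1}"
      unfolding range by (intro convexD) auto
    then obtain t where t: "t \<in> {0..<1}" and eq: "(1/2) *\<^sub>R B 0 + (1/2) *\<^sub>R B (1/2) = B t"
      by auto
    have "2 - \<alpha> \<noteq> 0" using nz[of "1/2"] by (auto simp: field_simps)
    then have "B 0 = 1" "B (1/2) = 1 / (2 - \<alpha>)"
      using nz[of "1/2"] by (simp_all add: B_def divide_simps)
    moreover have "B 0 + B (1/2) = 2 * B t"
      unfolding eq[symmetric] by (simp add: scaleR_conv_of_real distrib_left)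
    ultimately have "1 + 1 / (2 - \<alpha>) = 2 * B t" by simp
    then have "(3 - \<alpha>) * (1 - of_real t * \<alpha>) = 2 * (2 - \<alpha>) * (1 - of_real t)"
      using \<open>2 - \<alpha> \<noteq> 0\<close> nz[OF t] by (simp add: B_def field_simps)
    \<comment> \<open>The left side minus the right side of the previous equation is exactly this
      product. Its first factor reflects that \<open>B\<close> is constantly 1 when \<alpha> =
      1.\<close>
    then have "(1 - \<alpha>) * (of_real t * (4 - \<alpha>) - 1) = 0" by algebra
    then have "\<alpha> = 1 \<or> of_real t * (4 - \<alpha>) = 1" by auto
    then have "\<alpha> \<in> \<real>"
    proof
      assume *: "of_real t * (4 - \<alpha>) = 1"
      \<comment> \<open>For \<open>t\<close> = 0 the product would be 0. The imaginary part of the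
        equation says that \<open>t\<close> times Im \<alpha> vanishes, so \<alpha> is real.\<close>
      then have "t \<noteq> 0" by auto
      with arg_cong[OF *, of Im] show ?thesis by (simp add: complex_is_Real_iff)
    qed simp
    moreover have "\<bar>Re \<alpha>\<bar> \<le> 1" using abs_Re_le_cmod[of \<alpha>] \<alpha> by simp
    ultimately show "\<alpha> \<in> \<real> \<and> -1 \<le> Re \<alpha> \<and> Re \<alpha> \<le> 1" by auto
  next
    assume "\<alpha> \<in> \<real> \<and> -1 \<le> Re \<alpha> \<and> Re \<alpha> \<le> 1"
    then obtain a where a: "\<alpha> = of_real a" by (auto elim: Reals_cases)
    have nz': "1 - t * a \<noteq> 0" if "t \<in> {0..<1}" for t
      using nz[OF that] unfolding a by (metis of_real_1 of_real_diff of_real_mult of_real_0)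
    have "continuous_on {0..<1} (\<lambda>t. (1 - t) / (1 - t * a))"
      using nz' by (intro continuous_intros) auto
    then have "connected ((\<lambda>t. (1 - t) / (1 - t * a)) ` {0..<1})"
      by (rule connected_continuous_image) (simp add: is_interval_connected_1 flip: is_interval_co)
    \<comment> \<open>Connected subsets of the real line are intervals, hence convex; the image
      needs no explicit endpoints. The real-linear embedding \<open>complex_of_real\<close> then
      carries convexity into the plane.\<close>
    then have "convex ((\<lambda>t. (1 - t) / (1 - t * a)) ` {0..<1})"
      by (simp add: is_interval_connected_1 flip: is_interval_convex_1)
    then have "convex (complex_of_real ` (\<lambda>t. (1 - t) / (1 - t * a)) ` {0..<1})"
      by (rule convex_linear_image[OF linear_of_real])
    also have "complex_of_real ` (\<lambda>t. (1 - t) / (1 - t * a)) ` {0..<1} = B ` {0..<1}"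
      by (simp add: image_image B_def a)
    finally show "convex (berezin_range (composition_operator \<phi>))"
      unfolding range .
  qed
qed

end
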